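(* Let $\varepsilon>0$ and assume that the set $\{\eta(x):x\in\Omega\}$ spans $\mathbb{R}^K$. Then the nullspace of the Hessian of $\Phi_\varepsilon^G$ (at any $\boldsymbol\theta\in\mathbb{R}^{K\times N}$) consists only of vectors of the form $\mathbf{v}=(c,\dots,c)$ for some $c\in\mathbb{R}^K$, and the function $\Phi_\varepsilon^G$ is strictly concave on the orthogonal complement of this nullspace.
   Context: Let $\overline\Omega=[-1,1]^2$ and let $\Omega\subset\overline\Omega$ be a nonempty finite set (of pixels). Let $N>1$ and $K\ge 1$ be integers and $[N]:=\{1,\dots,N\}$. Let $G:\Omega\to[N]$ be a given map (the grain map) and $\eta:\overline\Omega\to\mathbb{R}^K$ a given function (the design function). For $\boldsymbol\theta=(\theta_1,\dots,\theta_N)\in\mathbb{R}^{K\times N}$ with $\theta_i\in\mathbb{R}^K$, set $h_{\theta_i}(x):=\theta_i\cdot\eta(x)$ for $x\in\overline\Omega$. Soft assignment, for $\varepsilon>0$: \[ (p_{\boldsymbol\theta}^\varepsilon)_i(x):=\frac{\exp\left(-\frac1\varepsilon h_{\theta_i}(x)\right)}{\sum_{j=1}^N\exp\left(-\frac1\varepsilon h_{\theta_j}(x)\right)},\qquad i\in[N]. \] Objective function, for $\varepsilon>0$: \[ \Phi_\varepsilon^G(\boldsymbol\theta):=\frac{1}{|\Omega|}\sum_{x\in\Omega}\log\big((p_{\boldsymbol\theta}^\varepsilon)_{G(x)}(x)\big). \] The orthogonal complement is taken in $\mathbb{R}^{K\times N}\cong\mathbb{R}^{KN}$ with the Euclidean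 inner product. *)

theory Defs
  imports "HOL-Analysis.Analysis"
begin

definition pixel_domain :: "(real \<times> real) set"
  where "pixel_domain = {-1..1} \<times> {-1..1}"

(* The finite index types 'n and 'k play the roles of {1..N} and {1..K}; a parameter
   \<theta> = (\<theta>_1, ..., \<theta>_N) in R^(K x N) has type real^'k^'n, with \<theta> $ i its column \<theta>_i.
   The inner product of this type is the Euclidean one of R^(KN). *)

definition potential :: "('p \<Rightarrow> real^'k) \<Rightarrow> real^'k \<Rightarrow> 'p \<Rightarrow> real"
  where "potential \<eta> t x = t \<bullet> \<eta> x"

definition soft_assignment ::
    "('p \<Rightarrow> real^'k) \<Rightarrow> real \<Rightarrow> real^'k^'n \<Rightarrow> 'n \<Rightarrow> 'p \<Rightarrow> real"
  where "soft_assignment \<eta> \<epsilon> \<theta> i x =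
    exp (- (1 / \<epsilon>) * potential \<eta> (\<theta> $ i) x) /
    (\<Sum>j\<in>UNIV. exp (- (1 / \<epsilon>) * potential \<eta> (\<theta> $ j) x))"

definition objective ::
    "'p set \<Rightarrow> ('p \<Rightarrow> real^'k) \<Rightarrow> ('p \<Rightarrow> 'n) \<Rightarrow> real \<Rightarrow> real^'k^'n \<Rightarrow> real"
  where "objective \<Omega> \<eta> G \<epsilon> \<theta> =
    1 / real (card \<Omega>) * (\<Sum>x\<in>\<Omega>. ln (soft_assignment \<eta> \<epsilon> \<theta> (G x) x))"

definition gradient :: "('a::real_inner \<Rightarrow> real) \<Rightarrow> 'a \<Rightarrow> 'a"
  where "gradient f x = (THE g. GDERIV f x :> g)"

(* The Hessian as a linear operator: hessian f x v is the Hessian matrix of f at x applied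
   to the vector v. The value is arbitrary where f is not twice differentiable. *)
definition hessian :: "('a::real_inner \<Rightarrow> real) \<Rightarrow> 'a \<Rightarrow> 'a \<Rightarrow> 'a"
  where "hessian f x = frechet_derivative (gradient f) (at x)"

definition hessian_nullspace :: "('a::real_inner \<Rightarrow> real) \<Rightarrow> 'a \<Rightarrow> 'a set"
  where "hessian_nullspace f x = {v. hessian f x v = 0}"

definition strictly_concave_on :: "'a::real_vector set \<Rightarrow> ('a \<Rightarrow> real) \<Rightarrow> bool"
  where "strictly_concave_on S f \<longleftrightarrow> convex S \<and>
    (\<forall>x\<in>S. \<forall>y\<in>S. \<forall>u>0. \<forall>v>0. x \<noteq> y \<and> u + v = 1 \<longrightarrow>
      f (u *\<^sub>R x + v *\<^sub>R y) > u * f x + v * f y)"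

lemma gradient_eqI:
  assumes "GDERIV f x :> g"
  shows "gradient f x = g"
  unfolding gradient_def
proof (rule the_equality)
  fix g' assume "GDERIV f x :> g'"
  then have "(\<lambda>h. h \<bullet> g') = (\<lambda>h. h \<bullet> g)"
    using assms has_derivative_unique[of f "\<lambda>h. h \<bullet> g'" x "\<lambda>h. h \<bullet> g"]
    by (simp add: gderiv_def)
  then have "h \<bullet> g' = h \<bullet> g" for h
    by (rule fun_cong)
  then show "g' = g"
    using vector_eq_ldot[of g' g] by blast
qed (fact assms)

lemma hessian_eqI:
  assumes "\<And>y. GDERIV f y :> g y" and "(g has_derivative H) (at x)"
  shows "hessian f x = H"
proof -
  have "gradient f = g"
    by (rule ext) (rule gradient_eqI[OF assms(1)])
  then show ?thesis
    by (simp add: hessian_def frechet_derivative_at[OF assms(2), symmetric])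
qed

end

theory Submission
  imports Defs
begin

text \<open>
  At a pixel \<open>x\<close> the soft assignment is a strictly positive probability distribution \<open>p\<close>
  on the indices, and a direction \<open>v\<close> gives a function \<open>s i = v $ i \<bullet> \<eta> x\<close> on the same
  indices. Everything depends on \<open>v\<close> only through how far these functions are from being
  constant.

  Differentiating twice shows that the quadratic form of the Hessian at \<open>v\<close> is
  \<open>- 1 / (card \<Omega> * \<epsilon>\<^sup>2)\<close> times the sum over the pixels of the variance of \<open>s\<close> under \<open>p\<close>
  (\<open>inner_objective_hessian\<close>). If \<open>v\<close> is in the nullspace, every variance is zero; as \<open>p\<close>
  has full support, \<open>s\<close> is constant at every pixel, that is, all differences of columns of
  \<open>v\<close> are orthogonal to every \<open>\<eta> x\<close>. The \<open>\<eta> x\<close> span the space, so the columns coincide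
  (\<open>constant_if_potentials_agree\<close>). Conversely, for equal columns \<open>s\<close> equals its mean and the
  Hessian vanishes.

  Strict concavity comes from first derivatives. The objective lies below its tangents,
  and strictly so in every direction whose columns are not all equal
  (\<open>objective_less_tangent\<close>). Pixelwise this is Jensen's inequality for the exponential,
  \<open>\<Sum>p i * d i \<le> ln (\<Sum>p i * exp (d i))\<close>, strict unless \<open>d\<close> is constant
  (\<open>weighted_mean_le_ln_sum_exp\<close>). Since the nullspace consists of all vectors with equal
  columns, two distinct points of its orthogonal complement never differ by such a vector,
  and strict tangent inequalities on a convex set give strict concavity
  (\<open>strictly_concave_onI_tangent\<close>).
\<close>

section \<open>Soft assignments as probability distributions\<close>

lemma soft_assignment_pos: "soft_assignment \<eta> \<epsilon> \<theta> i x > 0"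
  unfolding soft_assignment_def by (intro divide_pos_pos sum_pos) auto

lemma soft_assignment_sum_eq_1: "(\<Sum>i\<in>UNIV. soft_assignment \<eta> \<epsilon> \<theta> i x) = 1"
proof -
  have "(\<Sum>j\<in>UNIV. exp (- (1 / \<epsilon>) * potential \<eta> (\<theta> $ j) x)) > 0"
    by (intro sum_pos) auto
  then show ?thesis
    unfolding soft_assignment_def sum_divide_distrib[symmetric] by simp
qed

definition assignment_mean ::
    "('p \<Rightarrow> real^'k) \<Rightarrow> real \<Rightarrow> real^'k^'n \<Rightarrow> real^'k^'n \<Rightarrow> 'p \<Rightarrow> real"
  where "assignment_mean \<eta> \<epsilon> \<theta> v x =
    (\<Sum>j\<in>UNIV. soft_assignment \<eta> \<epsilon> \<theta> j x * potential \<eta> (v $ j) x)"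

section \<open>First and second derivatives\<close>

definition objective_gradient ::
    "'p set \<Rightarrow> ('p \<Rightarrow> real^'k) \<Rightarrow> ('p \<Rightarrow> 'n) \<Rightarrow> real \<Rightarrow> real^'k^'n \<Rightarrow> real^'k^'n"
  where "objective_gradient \<Omega> \<eta> G \<epsilon> \<theta> =
    (\<chi> i. \<Sum>x\<in>\<Omega>. (1 / real (card \<Omega>) * (1 / \<epsilon>) *
      (soft_assignment \<eta> \<epsilon> \<theta> i x - of_bool (i = G x))) *\<^sub>R \<eta> x)"

definition objective_hessian ::
    "'p set \<Rightarrow> ('p \<Rightarrow> real^'k) \<Rightarrow> real \<Rightarrow> real^'k^'n \<Rightarrow> real^'k^'n \<Rightarrow> real^'k^'n"
  where "objective_hessian \<Omega> \<eta> \<epsilon> \<theta> v =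
    (\<chi> i. \<Sum>x\<in>\<Omega>. (- (1 / real (card \<Omega>) * (1 / \<epsilon>)\<^sup>2) * soft_assignment \<eta> \<epsilon> \<theta> i x *
      (potential \<eta> (v $ i) x - assignment_mean \<eta> \<epsilon> \<theta> v x)) *\<^sub>R \<eta> x)"

text \<open>
  The quotient rule yields the familiar softmax formula: the logarithmic derivative of
  \<open>p i\<close> is the derivative of its exponent minus the mean over \<open>p\<close> of these derivatives.
\<close>
lemma soft_assignment_has_derivative:
  fixes \<theta> :: "real^'k^'n"
  shows "((\<lambda>\<theta>. soft_assignment \<eta> \<epsilon> \<theta> i x) has_derivative
    (\<lambda>v. - (1 / \<epsilon>) * soft_assignment \<eta> \<epsilon> \<theta> i x *
      (potential \<eta> (v $ i) x - assignment_mean \<eta> \<epsilon> \<theta> v x))) (at \<theta>)"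
proof -
  define e where "e \<theta>' j = exp (- (1 / \<epsilon>) * potential \<eta> (\<theta>' $ j) x)" for \<theta>' :: "real^'k^'n" and j
  define Z where "Z = (\<Sum>j\<in>UNIV. e \<theta> j)"
  have Z: "Z > 0"
    unfolding Z_def e_def by (intro sum_pos) auto
  have e': "((\<lambda>\<theta>. e \<theta> j) has_derivative
      (\<lambda>v. e \<theta> j * (- (1 / \<epsilon>) * potential \<eta> (v $ j) x))) (at \<theta>)" for j
  proof -
    have "((\<lambda>\<theta>::real^'k^'n. - (1 / \<epsilon>) * potential \<eta> (\<theta> $ j) x) has_derivative
        (\<lambda>v. - (1 / \<epsilon>) * potential \<eta> (v $ j) x)) (at \<theta>)"
      unfolding potential_def
      by (intro bounded_linear_imp_has_derivative bounded_linear_const_mult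
          bounded_linear_compose[OF bounded_linear_inner_left bounded_linear_vec_nth])
    from has_derivative_exp[OF this] show ?thesis
      unfolding e_def by (simp add: mult_ac)
  qed
  have s: "((\<lambda>\<theta>. \<Sum>j\<in>UNIV. e \<theta> j) has_derivative
      (\<lambda>v. \<Sum>j\<in>UNIV. e \<theta> j * (- (1 / \<epsilon>) * potential \<eta> (v $ j) x))) (at \<theta>)"
    by (intro has_derivative_sum e')
  have p: "soft_assignment \<eta> \<epsilon> \<theta> j x = e \<theta> j / Z" for j
    unfolding soft_assignment_def e_def Z_def ..
  have m: "(\<Sum>j\<in>UNIV. e \<theta> j * (- (1 / \<epsilon>) * potential \<eta> (v $ j) x))
      = - (1 / \<epsilon>) * Z * assignment_mean \<eta> \<epsilon> \<theta> v x" for v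
    unfolding assignment_mean_def p sum_distrib_left
    using Z by (intro sum.cong) auto
  have "((\<lambda>\<theta>. e \<theta> i / (\<Sum>j\<in>UNIV. e \<theta> j)) has_derivative
      (\<lambda>v. (e \<theta> i * (- (1 / \<epsilon>) * potential \<eta> (v $ i) x) * Z
        - e \<theta> i * (- (1 / \<epsilon>) * Z * assignment_mean \<eta> \<epsilon> \<theta> v x)) / (Z * Z))) (at \<theta>)"
    using has_derivative_divide'[OF e'[of i] s] Z unfolding m Z_def[symmetric] by simp
  also have "(\<lambda>v. (e \<theta> i * (- (1 / \<epsilon>) * potential \<eta> (v $ i) x) * Z
        - e \<theta> i * (- (1 / \<epsilon>) * Z * assignment_mean \<eta> \<epsilon> \<theta> v x)) / (Z * Z))
      = (\<lambda>v. - (1 / \<epsilon>) * soft_assignment \<eta> \<epsilon> \<theta> i x *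
          (potential \<eta> (v $ i) x - assignment_mean \<eta> \<epsilon> \<theta> v x))"
  proof
    fix v
    have "(a * (c * s) * Z - a * (c * Z * m)) / (Z * Z) = c * (a / Z) * (s - m)" for a c s m
      using Z by (simp add: divide_simps) (simp add: algebra_simps)
    from this[of "e \<theta> i" "- (1 / \<epsilon>)"] show "(e \<theta> i * (- (1 / \<epsilon>) * potential \<eta> (v $ i) x) * Z
        - e \<theta> i * (- (1 / \<epsilon>) * Z * assignment_mean \<eta> \<epsilon> \<theta> v x)) / (Z * Z)
      = - (1 / \<epsilon>) * soft_assignment \<eta> \<epsilon> \<theta> i x *
          (potential \<eta> (v $ i) x - assignment_mean \<eta> \<epsilon> \<theta> v x)"
      unfolding p .
  qed
  finally show ?thesis
    unfolding soft_assignment_def e_def .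
qed

text \<open>
  Written as a functional of the direction, the gradient is the average of the derivatives
  of \<open>ln (p (G x))\<close>. This is the form that differentiation produces and that the tangent
  inequality uses.
\<close>
lemma inner_objective_gradient:
  fixes v :: "real^'k^'n"
  shows "v \<bullet> objective_gradient \<Omega> \<eta> G \<epsilon> \<theta> =
    1 / real (card \<Omega>) * (\<Sum>x\<in>\<Omega>.
      - (1 / \<epsilon>) * (potential \<eta> (v $ G x) x - assignment_mean \<eta> \<epsilon> \<theta> v x))"
proof -
  have "v \<bullet> objective_gradient \<Omega> \<eta> G \<epsilon> \<theta> =
      (\<Sum>i\<in>UNIV. \<Sum>x\<in>\<Omega>. 1 / real (card \<Omega>) * (1 / \<epsilon>) *
        (soft_assignment \<eta> \<epsilon> \<theta> i x - of_bool (i = G x)) * potential \<eta> (v $ i) x)"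
    by (simp add: objective_gradient_def inner_vec_def[of v] inner_sum_right potential_def)
  also have "\<dots> = (\<Sum>x\<in>\<Omega>. \<Sum>i\<in>UNIV. 1 / real (card \<Omega>) * (1 / \<epsilon>) *
        (soft_assignment \<eta> \<epsilon> \<theta> i x - of_bool (i = G x)) * potential \<eta> (v $ i) x)"
    by (rule sum.swap)
  also have "\<dots> = (\<Sum>x\<in>\<Omega>. 1 / real (card \<Omega>) *
      (- (1 / \<epsilon>) * (potential \<eta> (v $ G x) x - assignment_mean \<eta> \<epsilon> \<theta> v x)))"
  proof (rule sum.cong[OF refl])
    fix x
    have delta: "(\<Sum>i\<in>UNIV. of_bool (i = G x) * potential \<eta> (v $ i) x)
        = potential \<eta> (v $ G x) x"
      by (simp add: of_bool_def if_distrib[of "\<lambda>b. b * _"] cong: if_cong)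
    have "(\<Sum>i\<in>UNIV. 1 / real (card \<Omega>) * (1 / \<epsilon>) *
        (soft_assignment \<eta> \<epsilon> \<theta> i x - of_bool (i = G x)) * potential \<eta> (v $ i) x)
      = 1 / real (card \<Omega>) * (1 / \<epsilon>) * (\<Sum>i\<in>UNIV. soft_assignment \<eta> \<epsilon> \<theta> i x *
          potential \<eta> (v $ i) x - of_bool (i = G x) * potential \<eta> (v $ i) x)"
      by (simp add: sum_distrib_left algebra_simps)
    also have "\<dots> = 1 / real (card \<Omega>) *
      (- (1 / \<epsilon>) * (potential \<eta> (v $ G x) x - assignment_mean \<eta> \<epsilon> \<theta> v x))"
      unfolding sum_subtractf delta assignment_mean_def[symmetric] by (simp add: algebra_simps)
    finally show "(\<Sum>i\<in>UNIV. 1 / real (card \<Omega>) * (1 / \<epsilon>) *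
        (soft_assignment \<eta> \<epsilon> \<theta> i x - of_bool (i = G x)) * potential \<eta> (v $ i) x) = \<dots>" .
  qed
  finally show ?thesis
    by (simp add: sum_distrib_left)
qed

lemma GDERIV_objective:
  "GDERIV (objective \<Omega> \<eta> G \<epsilon>) \<theta> :> objective_gradient \<Omega> \<eta> G \<epsilon> \<theta>"
proof -
  have "((\<lambda>\<theta>. ln (soft_assignment \<eta> \<epsilon> \<theta> (G x) x)) has_derivative
      (\<lambda>v. - (1 / \<epsilon>) * (potential \<eta> (v $ G x) x - assignment_mean \<eta> \<epsilon> \<theta> v x))) (at \<theta>)" for x
    using soft_assignment_pos[of \<eta> \<epsilon> \<theta> "G x" x]
    by (auto intro!: has_derivative_eq_rhs[OF has_derivative_ln[OF _ soft_assignment_has_derivative]])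
  then show ?thesis
    unfolding gderiv_def inner_objective_gradient objective_def
    by (intro has_derivative_mult_right has_derivative_sum)
qed

lemma has_derivative_vec:
  fixes f :: "'a::real_normed_vector \<Rightarrow> 'n::finite \<Rightarrow> 'b::euclidean_space"
  assumes "\<And>i. ((\<lambda>x. f x i) has_derivative (\<lambda>h. f' h i)) (at x within S)"
  shows "((\<lambda>x. \<chi> i. f x i) has_derivative (\<lambda>h. \<chi> i. f' h i)) (at x within S)"
proof (rule has_derivative_componentwise_within[THEN iffD2], rule ballI)
  fix e :: "'b^'n"
  assume "e \<in> Basis"
  then obtain i b where "e = axis i b"
    by (auto simp: Basis_vec_def)
  then show "((\<lambda>x. (\<chi> i. f x i) \<bullet> e) has_derivative (\<lambda>h. (\<chi> i. f' h i) \<bullet> e)) (at x within S)"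
    using has_derivative_inner_left[OF assms[of i], of b] by (simp add: inner_axis)
qed

lemma objective_gradient_has_derivative:
  "(objective_gradient \<Omega> \<eta> G \<epsilon> has_derivative objective_hessian \<Omega> \<eta> \<epsilon> \<theta>) (at \<theta>)"
  unfolding objective_gradient_def objective_hessian_def
proof (rule has_derivative_vec)
  fix i
  let ?C = "1 / real (card \<Omega>) * (1 / \<epsilon>)"
  let ?d = "\<lambda>v x. potential \<eta> (v $ i) x - assignment_mean \<eta> \<epsilon> \<theta> v x"
  have "((\<lambda>\<theta>. soft_assignment \<eta> \<epsilon> \<theta> i x - of_bool (i = G x)) has_derivative
      (\<lambda>v. - (1 / \<epsilon>) * soft_assignment \<eta> \<epsilon> \<theta> i x * ?d v x)) (at \<theta>)" for x
    by (rule has_derivative_eq_rhs[OF has_derivative_diff[OF soft_assignment_has_derivative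
            has_derivative_const]]) simp
  then have "((\<lambda>\<theta>. \<Sum>x\<in>\<Omega>. (?C * (soft_assignment \<eta> \<epsilon> \<theta> i x - of_bool (i = G x))) *\<^sub>R \<eta> x)
      has_derivative
      (\<lambda>v. \<Sum>x\<in>\<Omega>. (?C * (- (1 / \<epsilon>) * soft_assignment \<eta> \<epsilon> \<theta> i x * ?d v x)) *\<^sub>R \<eta> x)) (at \<theta>)"
    by (intro has_derivative_sum has_derivative_scaleR_left has_derivative_mult_right)
  then show "((\<lambda>\<theta>. \<Sum>x\<in>\<Omega>. (?C * (soft_assignment \<eta> \<epsilon> \<theta> i x - of_bool (i = G x))) *\<^sub>R \<eta> x)
      has_derivative
      (\<lambda>v. \<Sum>x\<in>\<Omega>. (- (1 / real (card \<Omega>) * (1 / \<epsilon>)\<^sup>2) * soft_assignment \<eta> \<epsilon> \<theta> i x * ?d v x)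
        *\<^sub>R \<eta> x)) (at \<theta>)"
    by (simp add: power2_eq_square mult_ac)
qed

lemma hessian_objective:
  "hessian (objective \<Omega> \<eta> G \<epsilon>) \<theta> = objective_hessian \<Omega> \<eta> \<epsilon> \<theta>"
  by (rule hessian_eqI[OF GDERIV_objective objective_gradient_has_derivative])

section \<open>The nullspace of the Hessian\<close>

lemma constant_if_potentials_agree:
  fixes v :: "real^'k^'n" and \<eta> :: "'p \<Rightarrow> real^'k"
  assumes "span (\<eta> ` \<Omega>) = UNIV"
    and "\<And>x i j. x \<in> \<Omega> \<Longrightarrow> potential \<eta> (v $ i) x = potential \<eta> (v $ j) x"
  shows "\<exists>c. v = (\<chi> i. c)"
proof -
  have "v $ i = v $ j" for i j
  proof -
    have "orthogonal (v $ i - v $ j) y" if "y \<in> \<eta> ` \<Omega>" for y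
      using that assms(2) by (auto simp: orthogonal_def potential_def inner_diff_left)
    then have "orthogonal (v $ i - v $ j) (v $ i - v $ j)"
      using orthogonal_to_span[of "v $ i - v $ j" "\<eta> ` \<Omega>" "v $ i - v $ j"] assms(1) by simp
    then show ?thesis
      by (simp add: orthogonal_def)
  qed
  \<comment> \<open>All columns agree, so an arbitrary index picks out the common value.\<close>
  then have "v = (\<chi> i. v $ undefined)"
    by (simp add: vec_eq_iff)
  then show ?thesis ..
qed

text \<open>
  Deviations from the mean average to zero, so \<open>s i\<close> may be replaced by \<open>s i - m\<close>.
\<close>
lemma sum_weighted_centered_square:
  fixes p s :: "'i \<Rightarrow> real"
  assumes "(\<Sum>i\<in>I. p i) = 1"
  defines "m \<equiv> \<Sum>i\<in>I. p i * s i"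
  shows "(\<Sum>i\<in>I. p i * (s i - m) * s i) = (\<Sum>i\<in>I. p i * (s i - m)\<^sup>2)"
proof -
  have "(\<Sum>i\<in>I. p i * (s i - m)) = 0"
    using assms by (simp add: right_diff_distrib sum_subtractf sum_distrib_right[symmetric])
  then have "(\<Sum>i\<in>I. p i * (s i - m) * m) = 0"
    by (simp add: sum_distrib_right[symmetric])
  moreover have "p i * (s i - m)\<^sup>2 = p i * (s i - m) * s i - p i * (s i - m) * m" for i
    by (simp add: power2_eq_square algebra_simps)
  ultimately show ?thesis
    by (simp add: sum_subtractf)
qed

text \<open>
  Pairing with \<open>v\<close> turns each pixel's contribution into the covariance of the potentials
  of \<open>v\<close> with themselves, so the quadratic form is a nonpositive multiple of a sum of variances. This is what lets one
  conclude from a vanishing sum that every summand vanishes.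
\<close>
lemma inner_objective_hessian:
  "v \<bullet> objective_hessian \<Omega> \<eta> \<epsilon> \<theta> v =
    - (1 / real (card \<Omega>) * (1 / \<epsilon>)\<^sup>2) * (\<Sum>x\<in>\<Omega>. \<Sum>i\<in>UNIV. soft_assignment \<eta> \<epsilon> \<theta> i x *
      (potential \<eta> (v $ i) x - assignment_mean \<eta> \<epsilon> \<theta> v x)\<^sup>2)"
proof -
  define C where "C = - (1 / real (card \<Omega>) * (1 / \<epsilon>)\<^sup>2)"
  have "v \<bullet> objective_hessian \<Omega> \<eta> \<epsilon> \<theta> v =
      (\<Sum>i\<in>UNIV. \<Sum>x\<in>\<Omega>. C * (soft_assignment \<eta> \<epsilon> \<theta> i x *
        (potential \<eta> (v $ i) x - assignment_mean \<eta> \<epsilon> \<theta> v x) * potential \<eta> (v $ i) x))"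
    unfolding objective_hessian_def inner_vec_def[of v] C_def[symmetric]
    by (simp add: inner_sum_right potential_def mult.assoc)
  also have "\<dots> = (\<Sum>x\<in>\<Omega>. \<Sum>i\<in>UNIV. C * (soft_assignment \<eta> \<epsilon> \<theta> i x *
        (potential \<eta> (v $ i) x - assignment_mean \<eta> \<epsilon> \<theta> v x) * potential \<eta> (v $ i) x))"
    by (rule sum.swap)
  also have "\<dots> = C * (\<Sum>x\<in>\<Omega>. \<Sum>i\<in>UNIV. soft_assignment \<eta> \<epsilon> \<theta> i x *
      (potential \<eta> (v $ i) x - assignment_mean \<eta> \<epsilon> \<theta> v x)\<^sup>2)"
    unfolding sum_distrib_left[symmetric] assignment_mean_def
    by (subst sum_weighted_centered_square[OF soft_assignment_sum_eq_1]) (rule refl)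
  finally show ?thesis
    unfolding C_def .
qed

lemma hessian_nullspace_objective:
  fixes \<theta> :: "real^'k^'n"
  assumes "finite \<Omega>" and "\<Omega> \<noteq> {}" and "\<epsilon> \<noteq> 0" and "span (\<eta> ` \<Omega>) = UNIV"
  shows "hessian_nullspace (objective \<Omega> \<eta> G \<epsilon>) \<theta> = {v. \<exists>c. v = (\<chi> i. c)}"
proof (rule set_eqI)
  fix v :: "real^'k^'n"
  let ?p = "\<lambda>i x. soft_assignment \<eta> \<epsilon> \<theta> i x"
  let ?d = "\<lambda>i x. potential \<eta> (v $ i) x - assignment_mean \<eta> \<epsilon> \<theta> v x"
  have p_nonneg: "?p i x \<ge> 0" for i x
    by (rule less_imp_le[OF soft_assignment_pos])
  have "objective_hessian \<Omega> \<eta> \<epsilon> \<theta> v = 0 \<longleftrightarrow> (\<exists>c. v = (\<chi> i. c))"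
  proof
    assume "objective_hessian \<Omega> \<eta> \<epsilon> \<theta> v = 0"
    then have "v \<bullet> objective_hessian \<Omega> \<eta> \<epsilon> \<theta> v = 0"
      by simp
    then have "(\<Sum>x\<in>\<Omega>. \<Sum>i\<in>UNIV. ?p i x * (?d i x)\<^sup>2) = 0"
      unfolding inner_objective_hessian using assms by simp
    then have "(\<Sum>i\<in>UNIV. ?p i x * (?d i x)\<^sup>2) = 0" if "x \<in> \<Omega>" for x
      using that assms(1) p_nonneg
      by (subst (asm) sum_nonneg_eq_0_iff) (auto intro!: sum_nonneg mult_nonneg_nonneg)
    then have "?p i x * (?d i x)\<^sup>2 = 0" if "x \<in> \<Omega>" for i x
      using that p_nonneg
      by (subst (asm) sum_nonneg_eq_0_iff) (auto intro!: mult_nonneg_nonneg)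
    then have "potential \<eta> (v $ i) x = assignment_mean \<eta> \<epsilon> \<theta> v x" if "x \<in> \<Omega>" for i x
      using that soft_assignment_pos[of \<eta> \<epsilon> \<theta> i x]
      by (metis diff_eq_diff_eq diff_self less_irrefl mult_eq_0_iff power_eq_0_iff)
    then show "\<exists>c. v = (\<chi> i. c)"
      by (intro constant_if_potentials_agree[OF assms(4)]) simp
  next
    assume "\<exists>c. v = (\<chi> i. c)"
    then have "?d i x = 0" for i x
      by (auto simp: assignment_mean_def sum_distrib_right[symmetric] soft_assignment_sum_eq_1)
    then show "objective_hessian \<Omega> \<eta> \<epsilon> \<theta> v = 0"
      unfolding objective_hessian_def by (simp add: vec_eq_iff)
  qed
  then show "v \<in> hessian_nullspace (objective \<Omega> \<eta> G \<epsilon>) \<theta> \<longleftrightarrow> v \<in> {v. \<exists>c. v = (\<chi> i. c)}"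
    by (simp add: hessian_nullspace_def hessian_objective)
qed

section \<open>Strict concavity\<close>

text \<open>
  To keep track of the equality case, the proof averages the tangent bound \<open>1 + t \<le> exp t\<close> at \<open>t = d i - m\<close>. The linear parts average
  to \<open>1\<close> because \<open>m\<close> is the mean, and the bound is strict at each index where \<open>d i \<noteq> m\<close>.
\<close>
lemma weighted_mean_le_ln_sum_exp:
  fixes p d :: "'i \<Rightarrow> real"
  assumes "finite I" and "\<And>i. i \<in> I \<Longrightarrow> p i > 0" and sum1: "(\<Sum>i\<in>I. p i) = 1"
  defines "m \<equiv> \<Sum>i\<in>I. p i * d i"
  shows "m \<le> ln (\<Sum>i\<in>I. p i * exp (d i))"
    and "\<exists>i\<in>I. d i \<noteq> m \<Longrightarrow> m < ln (\<Sum>i\<in>I. p i * exp (d i))"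
proof -
  have I: "I \<noteq> {}"
    using sum1 by auto
  have pos: "(\<Sum>i\<in>I. p i * exp (d i)) > 0"
    using assms(1,2) I by (intro sum_pos) auto
  have linear: "(\<Sum>i\<in>I. p i * (1 + (d i - m))) = 1"
  proof -
    have "p i * (1 + (d i - m)) = p i + (p i * d i - p i * m)" for i
      by (simp add: algebra_simps)
    then have "(\<Sum>i\<in>I. p i * (1 + (d i - m))) = (\<Sum>i\<in>I. p i) + (m - (\<Sum>i\<in>I. p i) * m)"
      by (simp add: m_def sum.distrib sum_subtractf flip: sum_distrib_right)
    then show ?thesis
      using sum1 by simp
  qed
  have shift: "(\<Sum>i\<in>I. p i * exp (d i - m)) = (\<Sum>i\<in>I. p i * exp (d i)) / exp m"
    by (simp add: exp_diff sum_divide_distrib)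
  have term_le: "p i * (1 + (d i - m)) \<le> p i * exp (d i - m)" if "i \<in> I" for i
    using assms(2)[OF that] by (intro mult_left_mono exp_ge_add_one_self) simp
  have "(\<Sum>i\<in>I. p i * (1 + (d i - m))) \<le> (\<Sum>i\<in>I. p i * exp (d i - m))"
    by (intro sum_mono term_le)
  then have "exp m \<le> (\<Sum>i\<in>I. p i * exp (d i))"
    unfolding linear shift by simp
  then show "m \<le> ln (\<Sum>i\<in>I. p i * exp (d i))"
    using pos by (simp add: ln_ge_iff)
  assume "\<exists>i\<in>I. d i \<noteq> m"
  then obtain k where k: "k \<in> I" "d k \<noteq> m"
    by blast
  have "(\<Sum>i\<in>I. p i * (1 + (d i - m))) < (\<Sum>i\<in>I. p i * exp (d i - m))"
  proof (rule sum_strict_mono_ex1[OF assms(1)])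
    show "\<forall>i\<in>I. p i * (1 + (d i - m)) \<le> p i * exp (d i - m)"
      using term_le by blast
    show "\<exists>i\<in>I. p i * (1 + (d i - m)) < p i * exp (d i - m)"
      using k assms(2)[OF k(1)] exp_minus_greater[of "m - d k"]
      by (intro bexI[of _ k] mult_strict_left_mono) auto
  qed
  then have "exp m < (\<Sum>i\<in>I. p i * exp (d i))"
    unfolding linear shift by simp
  then show "m < ln (\<Sum>i\<in>I. p i * exp (d i))"
    using pos by (metis exp_less_cancel_iff exp_ln)
qed

text \<open>
  Moving the parameter by \<open>w\<close> multiplies the exponential weights by \<open>exp (d j x)\<close>, so the
  new normalising sum is the old one times the mean of \<open>exp (d j x)\<close> under the old
  distribution. This reduces the comparison of two parameters to the inequality between
  \<open>\<Sum>p i * d i\<close> and \<open>ln (\<Sum>p i * exp (d i))\<close>.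
\<close>
lemma ln_soft_assignment_add:
  fixes \<theta> w :: "real^'k^'n" and \<eta> :: "'p \<Rightarrow> real^'k" and \<epsilon> :: real
  defines "d \<equiv> \<lambda>j x. - (1 / \<epsilon>) * potential \<eta> (w $ j) x"
  shows "ln (soft_assignment \<eta> \<epsilon> (\<theta> + w) i x) = ln (soft_assignment \<eta> \<epsilon> \<theta> i x) + d i x
    - ln (\<Sum>j\<in>UNIV. soft_assignment \<eta> \<epsilon> \<theta> j x * exp (d j x))"
proof -
  define e where "e j = exp (- (1 / \<epsilon>) * potential \<eta> (\<theta> $ j) x)" for j
  define Z where "Z = (\<Sum>j\<in>UNIV. e j)"
  have Z: "Z > 0"
    unfolding Z_def e_def by (intro sum_pos) auto
  have p: "soft_assignment \<eta> \<epsilon> \<theta> j x = e j / Z" for j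
    unfolding soft_assignment_def e_def Z_def ..
  have e_add: "exp (- (1 / \<epsilon>) * potential \<eta> ((\<theta> + w) $ j) x) = e j * exp (d j x)" for j
    unfolding e_def d_def potential_def exp_add[symmetric]
    by (simp add: inner_add_left add_divide_distrib)
  let ?S = "\<Sum>j\<in>UNIV. soft_assignment \<eta> \<epsilon> \<theta> j x * exp (d j x)"
  have S: "?S > 0"
    by (intro sum_pos mult_pos_pos soft_assignment_pos) auto
  have "soft_assignment \<eta> \<epsilon> (\<theta> + w) i x = e i * exp (d i x) / (\<Sum>j\<in>UNIV. e j * exp (d j x))"
    unfolding soft_assignment_def e_add ..
  also have "(\<Sum>j\<in>UNIV. e j * exp (d j x)) = Z * ?S"
    using Z by (simp add: p sum_distrib_left)
  also have "e i * exp (d i x) / (Z * ?S) = soft_assignment \<eta> \<epsilon> \<theta> i x * exp (d i x) / ?S"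
    by (simp add: p)
  finally show ?thesis
    using S soft_assignment_pos[of \<eta> \<epsilon> \<theta> i x] by (simp add: ln_div ln_mult)
qed

text \<open>
  At a proper convex combination \<open>z\<close> of \<open>x\<close> and \<open>y\<close>, the tangent at \<open>z\<close> overestimates
  both end values; in the weighted average the linear terms cancel.
\<close>
lemma strictly_concave_onI_tangent:
  fixes f :: "'a::real_inner \<Rightarrow> real"
  assumes "convex S"
    and tangent: "\<And>z y. z \<in> S \<Longrightarrow> y \<in> S \<Longrightarrow> y \<noteq> z \<Longrightarrow> f y < f z + (y - z) \<bullet> g z"
  shows "strictly_concave_on S f"
  unfolding strictly_concave_on_def
proof (intro conjI ballI allI impI)
  fix x y and u v :: real
  assume S: "x \<in> S" "y \<in> S" and pos: "u > 0" "v > 0" and uv: "x \<noteq> y \<and> u + v = 1"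
  define z where "z = u *\<^sub>R x + v *\<^sub>R y"
  have z: "z \<in> S"
    unfolding z_def using assms(1) S pos uv by (intro convexD) auto
  have u: "u = 1 - v"
    using uv by simp
  have xz: "x - z = v *\<^sub>R (x - y)"
    unfolding z_def u by (simp add: algebra_simps)
  have yz: "y - z = u *\<^sub>R (y - x)"
    unfolding z_def u by (simp add: algebra_simps)
  have "x \<noteq> z" "y \<noteq> z"
    using xz yz pos uv by auto
  then have "u * f x < u * (f z + (x - z) \<bullet> g z)" "v * f y < v * (f z + (y - z) \<bullet> g z)"
    using tangent[OF z] S pos by auto
  then have "u * f x + v * f y <
      u * (f z + (x - z) \<bullet> g z) + v * (f z + (y - z) \<bullet> g z)"
    by simp
  also have "\<dots> = f z"
    unfolding xz yz u by (simp add: algebra_simps inner_diff_left)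
  finally show "f (u *\<^sub>R x + v *\<^sub>R y) > u * f x + v * f y"
    unfolding z_def .
qed (fact assms(1))

text \<open>
  As the \<open>\<eta> x\<close> span the space, a non-constant \<open>w\<close> gives some pixel at which the
  potentials of \<open>w\<close> are not all equal to their mean; strictness of Jensen's inequality there suffices, as no other pixel
  violates the weak inequality.
\<close>
lemma objective_less_tangent:
  fixes \<theta> w :: "real^'k^'n"
  assumes "finite \<Omega>" and "\<epsilon> \<noteq> 0" and "span (\<eta> ` \<Omega>) = UNIV" and "\<nexists>c. w = (\<chi> i. c)"
  shows "objective \<Omega> \<eta> G \<epsilon> (\<theta> + w) <
    objective \<Omega> \<eta> G \<epsilon> \<theta> + w \<bullet> objective_gradient \<Omega> \<eta> G \<epsilon> \<theta>"
proof -
  let ?p = "\<lambda>\<theta> i x. soft_assignment \<eta> \<epsilon> \<theta> i x"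
  let ?t = "\<lambda>x. ln (?p \<theta> (G x) x)
    + - (1 / \<epsilon>) * (potential \<eta> (w $ G x) x - assignment_mean \<eta> \<epsilon> \<theta> w x)"
  have mean: "(\<Sum>j\<in>UNIV. ?p \<theta> j x * (- (1 / \<epsilon>) * potential \<eta> (w $ j) x))
      = - (1 / \<epsilon>) * assignment_mean \<eta> \<epsilon> \<theta> w x" for x
    unfolding assignment_mean_def sum_distrib_left by (simp add: mult_ac)
  note jensen = weighted_mean_le_ln_sum_exp[OF finite soft_assignment_pos
      soft_assignment_sum_eq_1, where d = "\<lambda>j. - (1 / \<epsilon>) * potential \<eta> (w $ j) x" for x]
  have le: "ln (?p (\<theta> + w) (G x) x) \<le> ?t x" for x
    using jensen(1)[of \<eta> \<epsilon> \<theta> x x] unfolding ln_soft_assignment_add mean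
    by (simp add: right_diff_distrib)
  obtain x i where xi: "x \<in> \<Omega>" "potential \<eta> (w $ i) x \<noteq> assignment_mean \<eta> \<epsilon> \<theta> w x"
    using constant_if_potentials_agree[OF assms(3), of w] assms(4) by metis
  then have "\<exists>j\<in>UNIV. - (1 / \<epsilon>) * potential \<eta> (w $ j) x \<noteq> - (1 / \<epsilon>) * assignment_mean \<eta> \<epsilon> \<theta> w x"
    using assms(2) by auto
  then have "ln (?p (\<theta> + w) (G x) x) < ?t x"
    using jensen(2)[of x \<eta> \<epsilon> \<theta> x] unfolding ln_soft_assignment_add mean
    by (simp add: right_diff_distrib)
  then have "(\<Sum>x\<in>\<Omega>. ln (?p (\<theta> + w) (G x) x)) < (\<Sum>x\<in>\<Omega>. ?t x)"
    using le xi(1) by (intro sum_strict_mono_ex1 assms(1)) auto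
  moreover have "card \<Omega> > 0"
    using assms(1) xi(1) by (auto simp: card_gt_0_iff)
  ultimately have "1 / real (card \<Omega>) * (\<Sum>x\<in>\<Omega>. ln (?p (\<theta> + w) (G x) x))
      < 1 / real (card \<Omega>) * (\<Sum>x\<in>\<Omega>. ?t x)"
    by (intro mult_strict_left_mono) auto
  then show ?thesis
    unfolding objective_def inner_objective_gradient sum.distrib distrib_left .
qed

theorem proposition4p5:
  fixes \<Omega> :: "(real \<times> real) set"
    and \<eta> :: "real \<times> real \<Rightarrow> real^'k"
    and G :: "real \<times> real \<Rightarrow> 'n::finite"
    and \<epsilon> :: real
  assumes "finite \<Omega>" and "\<Omega> \<noteq> {}" and "\<Omega> \<subseteq> pixel_domain"
    and "CARD('n) > 1"
    and "\<epsilon> > 0"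
    and "span (\<eta> ` \<Omega>) = UNIV"
  shows "\<forall>\<theta> :: real^'k^'n.
    hessian_nullspace (objective \<Omega> \<eta> G \<epsilon>) \<theta> = {v. \<exists>c. v = (\<chi> i. c)} \<and>
    strictly_concave_on ((hessian_nullspace (objective \<Omega> \<eta> G \<epsilon>) \<theta>)\<^sup>\<bottom>) (objective \<Omega> \<eta> G \<epsilon>)"
proof
  fix \<theta> :: "real^'k^'n"
  let ?N = "{v :: real^'k^'n. \<exists>c. v = (\<chi> i. c)}"
  have \<epsilon>: "\<epsilon> \<noteq> 0"
    using assms(5) by simp
  have null: "hessian_nullspace (objective \<Omega> \<eta> G \<epsilon>) \<theta> = ?N"
    by (rule hessian_nullspace_objective[OF assms(1,2) \<epsilon> assms(6)])
  have "strictly_concave_on (?N\<^sup>\<bottom>) (objective \<Omega> \<eta> G \<epsilon>)"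
  proof (rule strictly_concave_onI_tangent)
    show "convex (?N\<^sup>\<bottom>)"
      by (intro subspace_imp_convex subspace_orthogonal_comp)
    fix z y :: "real^'k^'n"
    assume zy: "z \<in> ?N\<^sup>\<bottom>" "y \<in> ?N\<^sup>\<bottom>" "y \<noteq> z"
    \<comment> \<open>A vector in both \<open>?N\<close> and its orthogonal complement is orthogonal to itself.\<close>
    have "y - z \<in> ?N\<^sup>\<bottom>"
      using zy by (intro subspace_diff[OF subspace_orthogonal_comp])
    then have "y - z \<notin> ?N"
      using zy(3) by (auto simp: orthogonal_comp_def orthogonal_self)
    then show "objective \<Omega> \<eta> G \<epsilon> y <
        objective \<Omega> \<eta> G \<epsilon> z + (y - z) \<bullet> objective_gradient \<Omega> \<eta> G \<epsilon> z"
      using objective_less_tangent[OF assms(1) \<epsilon> assms(6), of "y - z" G z] by simp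
  qed
  with null show "hessian_nullspace (objective \<Omega> \<eta> G \<epsilon>) \<theta> = ?N \<and>
    strictly_concave_on ((hessian_nullspace (objective \<Omega> \<eta> G \<epsilon>) \<theta>)\<^sup>\<bottom>) (objective \<Omega> \<eta> G \<epsilon>)"
    by simp
qed

end
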